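(* For every $n\in\mathbb{N}$ (positive integers), the convex polytope $\mathcal{A}^{*}_{n}\subset\mathbb{R}^n$, defined as the convex hull of the vectors $v(G)$, $G\in\mathcal{G}_n$, has exactly $\frac{3^{n-1} + 1}{2}$ corners (vertices, i.e. extreme points).
   Context: $\mathcal{G}_n$ is the family of labelled digraphs (loops and multiple arcs allowed) on vertex set $\{1,\dots,n\}$ such that: (Rule 1) exactly two arcs go out from each vertex; (Rule 2) every arc $(i,j)$ (from $i$ to $j$) satisfies $j\le i$; (Rule 3) if $(i,j_1)$ and $(i,j_2)$ are the two outgoing arcs from $i$ and $j_1=j_2$, then $j_1=1$ or $j_1=i$. For $G\in\mathcal{G}_n$, $v(G)=(v_1,\dots,v_n)\in\mathbb{R}^n$ is given by $v_i=\frac{\mathrm{indeg}_G(i)}{2n}$, where each loop at $i$ counts once in the indegree of $i$. *)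

theory Defs
  imports "HOL-Analysis.Analysis" "Graph_Theory.Digraph"
begin

(* Arcs are named by natural numbers; every finite digraph has such a naming, and
   the indegrees do not depend on it. Parallel arcs are distinct names with the same
   tail and head, and a loop lies once in in_arcs, so it contributes 1 to in_degree. *)
definition digraph_family :: "nat \<Rightarrow> (nat, nat) pre_digraph set" where
  "digraph_family n = {G. fin_digraph G \<and> verts G = {1..n} \<and>
     (\<forall>i\<in>verts G. out_degree G i = 2) \<and>
     (\<forall>e\<in>arcs G. head G e \<le> tail G e) \<and>
     (\<forall>e1\<in>arcs G. \<forall>e2\<in>arcs G.
        e1 \<noteq> e2 \<longrightarrow> tail G e1 = tail G e2 \<longrightarrow> head G e1 = head G e2 \<longrightarrow>
        head G e1 = 1 \<or> head G e1 = tail G e1)}"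

(* The type real ^ 'n has no built-in numbering of its coordinates: lab is meant to be a
   bijection from 'n to {1..n}, and the component at k is the coordinate number lab k. *)
definition degree_vector ::
    "('n::finite \<Rightarrow> nat) \<Rightarrow> nat \<Rightarrow> (nat, nat) pre_digraph \<Rightarrow> real ^ 'n" where
  "degree_vector lab n G = (\<chi> k. real (in_degree G (lab k)) / (2 * real n))"

definition degree_polytope :: "('n::finite \<Rightarrow> nat) \<Rightarrow> nat \<Rightarrow> (real ^ 'n) set" where
  "degree_polytope lab n = convex hull (degree_vector lab n ` digraph_family n)"

end

theory Submission
  imports Defs "HOL-Library.Multiset"
begin

text \<open>Up to scaling, the vectors \<open>v(G)\<close> are the sums of one admissible pair of heads per vertex \<open>i\<close>,
  so a linear functional \<open>c\<close> is maximised on each vertex \<open>i\<close> separately. If \<open>a\<close> and \<open>b\<close> are the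
  positions of the largest and second largest value among \<open>c 1, \<dots>, c i\<close>, then the best pair is
  \<open>{a, a}\<close> when \<open>a\<close> is \<open>1\<close> or \<open>i\<close>, and \<open>{a, b}\<close> otherwise. Hence the corners correspond to the
  possible histories of \<open>(a, b)\<close> for \<open>i = 1, \<dots>, n\<close>, where \<open>b\<close> is forgotten while \<open>a = 1\<close>.
  A history with \<open>a = 1\<close> has two continuations, any other has three, so exactly one history of
  length \<open>n\<close> ends with \<open>a = 1\<close>, and the number \<open>B n\<close> of the others satisfies
  \<open>B (n + 1) = 3 * B n + 1\<close>.\<close>

section \<open>Digraphs as independent choices of two heads per vertex\<close>

text \<open>Multisets forget the names and the order of the two arcs but keep a doubled head, which
  is all that the indegrees see.\<close>

definition out_pairs :: "nat \<Rightarrow> nat multiset set" where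
  "out_pairs i = {{#u, v#} | u v. u \<in> {1..i} \<and> v \<in> {1..i} \<and> (u = v \<longrightarrow> u = 1 \<or> u = i)}"

definition pair_vector :: "('n::finite \<Rightarrow> nat) \<Rightarrow> nat \<Rightarrow> (nat \<Rightarrow> nat multiset) \<Rightarrow> real ^ 'n" where
  "pair_vector lab n p = (\<chi> k. real (\<Sum>i = 1..n. count (p i) (lab k)) / (2 * real n))"

lemma finite_out_pairs: "finite (out_pairs i)"
proof (rule finite_subset)
  show "out_pairs i \<subseteq> (\<lambda>(u, v). {#u, v#}) ` ({1..i} \<times> {1..i})"
    by (auto simp: out_pairs_def)
qed simp

lemma head_pair_in_out_pairs:
  assumes G: "G \<in> digraph_family n" and i: "i \<in> {1..n}"
  shows "image_mset (head G) (mset_set (out_arcs G i)) \<in> out_pairs i"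
proof -
  interpret fin_digraph G using G by (simp add: digraph_family_def)
  have "card (out_arcs G i) = 2"
    using G i by (auto simp: digraph_family_def out_degree_def)
  then obtain e f where ef: "out_arcs G i = {e, f}" "e \<noteq> f"
    by (auto simp: card_2_iff)
  have arcs: "e \<in> arcs G" "f \<in> arcs G" "tail G e = i" "tail G f = i"
    using ef(1) by (auto simp: out_arcs_def)
  have "head G e \<in> {1..n}" "head G f \<in> {1..n}"
    using arcs head_in_verts G by (auto simp: digraph_family_def)
  moreover have "head G e \<le> i" "head G f \<le> i"
    using G arcs by (auto simp: digraph_family_def)
  moreover have "head G e = head G f \<longrightarrow> head G e = 1 \<or> head G e = i"
    using G arcs ef(2) unfolding digraph_family_def by auto
  ultimately show ?thesis
    using ef by (auto simp: out_pairs_def)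
qed

text \<open>The arcs into \<open>k\<close> are sorted by their tails, and the multiplicity of
  \<open>k\<close> among the heads at \<open>i\<close> counts parallel arcs and loops
  correctly.\<close>

lemma in_degree_eq_sum:
  assumes G: "G \<in> digraph_family n"
  shows "in_degree G k = (\<Sum>i = 1..n. count (image_mset (head G) (mset_set (out_arcs G i))) k)"
proof -
  interpret fin_digraph G using G by (simp add: digraph_family_def)
  have V: "verts G = {1..n}" using G by (simp add: digraph_family_def)
  have "in_arcs G k = (\<Union>i\<in>{1..n}. {e \<in> out_arcs G i. head G e = k})"
    using tail_in_verts V by (auto simp: in_arcs_def out_arcs_def)
  then have "in_degree G k = (\<Sum>i = 1..n. card {e \<in> out_arcs G i. head G e = k})"
    unfolding in_degree_def by (simp, subst card_UN_disjoint) auto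
  moreover have "count (image_mset (head G) (mset_set (out_arcs G i))) k
      = card {e \<in> out_arcs G i. head G e = k}" for i
    by (subst count_image_mset_eq_card_vimage) (auto simp: finite_out_arcs)
  ultimately show ?thesis by simp
qed

text \<open>The three rules constrain each vertex separately, so admissible pairs can be chosen
  independently and assembled into one digraph.\<close>

lemma digraph_with_out_pairs:
  assumes "p \<in> (\<Pi> i\<in>{1..n}. out_pairs i)"
  shows "\<exists>G\<in>digraph_family n. \<forall>i\<in>{1..n}. image_mset (head G) (mset_set (out_arcs G i)) = p i"
proof -
  have "\<forall>i\<in>{1..n}. \<exists>u v. p i = {#u, v#} \<and> u \<in> {1..i} \<and> v \<in> {1..i} \<and> (u = v \<longrightarrow> u = 1 \<or> u = i)"
    using assms by (fastforce simp: out_pairs_def Pi_def)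
  then obtain u v where uv: "\<And>i. i \<in> {1..n} \<Longrightarrow> p i = {#u i, v i#} \<and> u i \<in> {1..i} \<and> v i \<in> {1..i}
      \<and> (u i = v i \<longrightarrow> u i = 1 \<or> u i = i)"
    by metis
  \<comment> \<open>The arcs leaving \<open>i\<close> are named \<open>2 * i\<close> and
    \<open>2 * i + 1\<close>: halving recovers the tail and parity selects the head. For
    \<open>i\<close> from \<open>1\<close> to \<open>n\<close> these names fill
    \<open>{2..<2 * n + 2}\<close>.\<close>
  define G :: "(nat, nat) pre_digraph" where
    "G = \<lparr>verts = {1..n}, arcs = {2..<2 * n + 2}, tail = (\<lambda>e. e div 2),
          head = (\<lambda>e. if even e then u (e div 2) else v (e div 2))\<rparr>"
  have arc: "e div 2 \<in> {1..n}" if "e \<in> arcs G" for e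
    using that by (auto simp: G_def)
  have out: "out_arcs G i = {2 * i, 2 * i + 1}" if "i \<in> {1..n}" for i
    using that by (auto simp: G_def out_arcs_def)
  have heads: "head G e = (if even e then u (e div 2) else v (e div 2))" "tail G e = e div 2" for e
    by (simp_all add: G_def)
  have "fin_digraph G"
  proof
    fix e assume e: "e \<in> arcs G"
    note uv[OF arc[OF e]]
    then show "head G e \<in> verts G"
      using arc[OF e] unfolding heads by (auto simp: G_def)
  qed (use arc in \<open>auto simp: G_def\<close>)
  moreover have "out_degree G i = 2" if "i \<in> verts G" for i
    using out[of i] that by (simp add: out_degree_def G_def)
  moreover have "head G e \<le> tail G e" if "e \<in> arcs G" for e
    using uv[OF arc[OF that]] unfolding heads by simp
  moreover have "head G e = 1 \<or> head G e = tail G e"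
    if "e \<in> arcs G" "f \<in> arcs G" "e \<noteq> f" "tail G e = tail G f" "head G e = head G f" for e f
  proof -
    \<comment> \<open>Distinct names with the same half differ in parity, so equal heads mean that
      the pair chosen at this vertex is doubled.\<close>
    have "even e \<noteq> even f"
      using that(3,4) unfolding heads by (metis bit_eq_rec)
    then have "u (e div 2) = v (e div 2)"
      using that(4,5) unfolding heads by (auto split: if_splits)
    then show ?thesis
      using uv[OF arc[OF that(1)]] unfolding heads by auto
  qed
  ultimately have "G \<in> digraph_family n"
    unfolding digraph_family_def by (auto simp: G_def)
  moreover have "image_mset (head G) (mset_set (out_arcs G i)) = p i" if "i \<in> {1..n}" for i
    using uv[OF that] by (simp add: out[OF that] heads)
  ultimately show ?thesis by blast
qed

text \<open>Choosing the extensional product \<open>\<Pi>\<^sub>E\<close> makes the index set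
  finite; no vector is lost, because \<open>pair_vector\<close> reads its argument on
  \<open>{1..n}\<close> only.\<close>

lemma degree_vector_image:
  "degree_vector lab n ` digraph_family n = pair_vector lab n ` (\<Pi>\<^sub>E i\<in>{1..n}. out_pairs i)"
proof (intro equalityI subsetI)
  fix x assume "x \<in> degree_vector lab n ` digraph_family n"
  then obtain G where G: "G \<in> digraph_family n" "x = degree_vector lab n G" by blast
  define p where "p = restrict (\<lambda>i. image_mset (head G) (mset_set (out_arcs G i))) {1..n}"
  have "p \<in> (\<Pi>\<^sub>E i\<in>{1..n}. out_pairs i)"
    unfolding p_def using head_pair_in_out_pairs[OF G(1)] by (intro restrict_PiE_iff[THEN iffD2]) auto
  moreover have "x = pair_vector lab n p"
    by (simp add: G(2) degree_vector_def pair_vector_def in_degree_eq_sum[OF G(1)] p_def)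
  ultimately show "x \<in> pair_vector lab n ` (\<Pi>\<^sub>E i\<in>{1..n}. out_pairs i)" by blast
next
  fix x assume "x \<in> pair_vector lab n ` (\<Pi>\<^sub>E i\<in>{1..n}. out_pairs i)"
  then obtain p where p: "p \<in> (\<Pi>\<^sub>E i\<in>{1..n}. out_pairs i)" "x = pair_vector lab n p" by blast
  then have "p \<in> (\<Pi> i\<in>{1..n}. out_pairs i)" by (simp add: PiE_def)
  from digraph_with_out_pairs[OF this] obtain G where G: "G \<in> digraph_family n"
    "\<And>i. i \<in> {1..n} \<Longrightarrow> image_mset (head G) (mset_set (out_arcs G i)) = p i" by blast
  have "x = degree_vector lab n G"
    using G(2) by (simp add: p(2) degree_vector_def pair_vector_def in_degree_eq_sum[OF G(1)])
  then show "x \<in> degree_vector lab n ` digraph_family n" using G(1) by blast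
qed

lemma pair_vector_restrict: "pair_vector lab n (restrict p {1..n}) = pair_vector lab n p"
  by (simp add: pair_vector_def)

section \<open>Linear functionals on the vectors\<close>

lemma sum_mset_image_mset_eq_sum:
  fixes c :: "'a \<Rightarrow> 'b::comm_semiring_1"
  assumes "finite S" "set_mset M \<subseteq> S"
  shows "(\<Sum>j\<in>#M. c j) = (\<Sum>j\<in>S. c j * of_nat (count M j))"
  using assms(2)
proof (induction M)
  case (add x M)
  have "(\<Sum>j\<in>S. c j * of_nat (count (add_mset x M) j))
      = (\<Sum>j\<in>S. (if j = x then c j else 0) + c j * of_nat (count M j))"
    by (rule sum.cong) (auto simp: distrib_left)
  also have "\<dots> = c x + (\<Sum>j\<in>S. c j * of_nat (count M j))"
    using add.prems assms(1) by (simp add: sum.distrib)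
  finally show ?case using add by simp
qed simp

text \<open>Exchanging the two sums splits the functional into one term per vertex \<open>i\<close>,
  so that maximising it means maximising the weight of each pair on its own. Here \<open>c\<close>
  is \<open>y\<close> with its coordinates renumbered by \<open>lab\<close>.\<close>

lemma inner_pair_vector:
  fixes lab :: "'n::finite \<Rightarrow> nat" and y :: "real ^ 'n"
  assumes lab: "bij_betw lab UNIV {1..n}" and p: "p \<in> (\<Pi> i\<in>{1..n}. out_pairs i)"
    and c: "\<And>k. c (lab k) = y $ k"
  shows "y \<bullet> pair_vector lab n p = (\<Sum>i = 1..n. \<Sum>j\<in>#p i. c j) / (2 * real n)"
proof -
  have "(\<Sum>k\<in>UNIV. c (lab k) * real (count (p i) (lab k))) = (\<Sum>j\<in>#p i. c j)"
    if i: "i \<in> {1..n}" for i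
  proof -
    have sub: "set_mset (p i) \<subseteq> {1..n}"
      using p i by (fastforce simp: out_pairs_def Pi_def)
    have "(\<Sum>k\<in>UNIV. c (lab k) * real (count (p i) (lab k)))
        = (\<Sum>j\<in>{1..n}. c j * real (count (p i) j))"
      by (rule sum.reindex_bij_betw[OF lab])
    also have "\<dots> = (\<Sum>j\<in>#p i. c j)"
      using sum_mset_image_mset_eq_sum[OF _ sub, of c] by simp
    finally show ?thesis .
  qed
  then have "(\<Sum>i = 1..n. \<Sum>j\<in>#p i. c j)
      = (\<Sum>i = 1..n. \<Sum>k\<in>UNIV. c (lab k) * real (count (p i) (lab k)))" by simp
  also have "\<dots> = (\<Sum>k\<in>UNIV. \<Sum>i = 1..n. c (lab k) * real (count (p i) (lab k)))"
    by (rule sum.swap)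
  finally show ?thesis
    by (simp add: inner_vec_def pair_vector_def c sum_distrib_left sum_divide_distrib)
qed

section \<open>Extreme points as unique maximisers\<close>

text \<open>Every face of a polytope is exposed, which gives a functional maximised at
  \<open>x\<close> alone. Conversely, the other points lie in an open half-space that misses
  \<open>x\<close>; it is convex, so their hull misses \<open>x\<close> too.\<close>

lemma extreme_point_of_convex_hull_iff:
  fixes V :: "'a::euclidean_space set"
  assumes V: "finite V"
  shows "x extreme_point_of (convex hull V) \<longleftrightarrow>
    x \<in> V \<and> (\<exists>y. \<forall>z\<in>V. z \<noteq> x \<longrightarrow> y \<bullet> z < y \<bullet> x)"
proof
  assume x: "x extreme_point_of (convex hull V)"
  then have xV: "x \<in> V" by (rule extreme_point_of_convex_hull)
  have "{x} face_of (convex hull V)" using x by (simp add: face_of_singleton)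
  then have "{x} exposed_face_of (convex hull V)"
    using V by (simp add: exposed_face_of_polyhedron polytope_imp_polyhedron polytope_convex_hull)
  then obtain a b where ab: "convex hull V \<subseteq> {z. a \<bullet> z \<le> b}" "{x} = convex hull V \<inter> {z. a \<bullet> z = b}"
    unfolding exposed_face_of_def by auto
  have "a \<bullet> z < a \<bullet> x" if "z \<in> V" "z \<noteq> x" for z
  proof -
    have z: "z \<in> convex hull V" using that(1) by (rule hull_inc)
    have "a \<bullet> z \<le> b" using ab(1) z by blast
    moreover have "a \<bullet> z \<noteq> b" using ab(2) z that(2) by blast
    moreover have "a \<bullet> x = b" using ab(2) by blast
    ultimately show ?thesis by simp
  qed
  then show "x \<in> V \<and> (\<exists>y. \<forall>z\<in>V. z \<noteq> x \<longrightarrow> y \<bullet> z < y \<bullet> x)" using xV by blast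
next
  assume "x \<in> V \<and> (\<exists>y. \<forall>z\<in>V. z \<noteq> x \<longrightarrow> y \<bullet> z < y \<bullet> x)"
  then obtain y where y: "x \<in> V" "\<And>z. z \<in> V \<Longrightarrow> z \<noteq> x \<Longrightarrow> y \<bullet> z < y \<bullet> x" by blast
  have "convex hull (V - {x}) \<subseteq> {z. y \<bullet> z < y \<bullet> x}"
  proof (rule hull_minimal)
    show "V - {x} \<subseteq> {z. y \<bullet> z < y \<bullet> x}" using y(2) by blast
  qed (rule convex_halfspace_lt)
  then have "x \<notin> convex hull (V - {x})" by auto
  then have "x extreme_point_of (convex hull (insert x (V - {x})))"
    using V by (intro extreme_point_of_convex_hull_insert) auto
  then show "x extreme_point_of (convex hull V)" using y(1) by (simp add: insert_absorb)
qed

section \<open>Leader histories and the pairs they determine\<close>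

text \<open>The new position \<open>Suc i\<close> becomes first, becomes second, or changes nothing.
  While \<open>a = 1\<close> the runner-up is not tracked and \<open>b = 1\<close> is a placeholder,
  so the last two outcomes merge.\<close>

definition next_leaders :: "nat \<Rightarrow> nat \<times> nat \<Rightarrow> (nat \<times> nat) set" where
  "next_leaders i = (\<lambda>(a, b).
     if a = 1 then {(1, 1), (Suc i, 1)} else {(Suc i, a), (a, Suc i), (a, b)})"

text \<open>The histories of length \<open>Suc m\<close>, continued by the junk value \<open>(1, 1)\<close>.\<close>

fun leader_paths :: "nat \<Rightarrow> (nat \<Rightarrow> nat \<times> nat) set" where
  "leader_paths 0 = {\<lambda>_. (1, 1)}"
| "leader_paths (Suc m) =
     (\<Union>s\<in>leader_paths m. (\<lambda>t. s(Suc (Suc m) := t)) ` next_leaders (Suc m) (s (Suc m)))"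

text \<open>The case \<open>a = 1\<close> needs no branch of its own: the placeholder
  \<open>b = 1\<close> already yields the doubled pair.\<close>

definition leader_pair :: "nat \<Rightarrow> nat \<times> nat \<Rightarrow> nat multiset" where
  "leader_pair i = (\<lambda>(a, b). if a = i then {#a, a#} else {#a, b#})"

text \<open>The relation is a parameter because a weight built for a given history can be strict
  (\<open><\<close>), while an arbitrary weight may have ties (\<open>\<le>\<close>) and then
  several valid states.\<close>

definition leading :: "(real \<Rightarrow> real \<Rightarrow> bool) \<Rightarrow> (nat \<Rightarrow> real) \<Rightarrow> nat \<Rightarrow> nat \<times> nat \<Rightarrow> bool" where
  "leading R c i = (\<lambda>(a, b). a \<in> {1..i} \<and> b \<in> {1..i} \<and> (\<forall>j\<in>{1..i}. j \<noteq> a \<longrightarrow> R (c j) (c a)) \<and>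
     (if a = 1 then b = 1 else b \<noteq> a \<and> (\<forall>j\<in>{1..i}. j \<noteq> a \<longrightarrow> j \<noteq> b \<longrightarrow> R (c j) (c b))))"

section \<open>Optimality of the leader pair\<close>

text \<open>If the leader may be doubled, any other pair has an entry that is strictly worse.
  Otherwise the leader occurs at most once in \<open>q\<close>, and what remains cannot beat the
  runner-up.\<close>

lemma leader_pair_strict_max:
  assumes s: "leading (<) c i s" and q: "q \<in> out_pairs i" "q \<noteq> leader_pair i s"
  shows "(\<Sum>j\<in>#q. c j) < (\<Sum>j\<in>#leader_pair i s. c j)"
proof -
  obtain a b where ab: "s = (a, b)" by (cases s)
  obtain u v where uv: "q = {#u, v#}" "u \<in> {1..i}" "v \<in> {1..i}" "u = v \<Longrightarrow> u = 1 \<or> u = i"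
    using q(1) by (auto simp: out_pairs_def)
  have top: "u \<noteq> a \<Longrightarrow> c u < c a" "v \<noteq> a \<Longrightarrow> c v < c a"
    using s uv by (auto simp: ab leading_def)
  show ?thesis
  proof (cases "a = 1 \<or> a = i")
    case True
    then have p: "leader_pair i s = {#a, a#}"
      using s by (auto simp: ab leading_def leader_pair_def)
    have "u \<noteq> a \<or> v \<noteq> a" using q(2) by (auto simp: p uv(1))
    then show ?thesis using top unfolding p uv(1) by (cases "u = a"; cases "v = a") auto
  next
    case False
    then have p: "leader_pair i s = {#a, b#}"
      by (auto simp: ab leader_pair_def)
    have sec: "u \<noteq> a \<Longrightarrow> u \<noteq> b \<Longrightarrow> c u < c b" "v \<noteq> a \<Longrightarrow> v \<noteq> b \<Longrightarrow> c v < c b"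
      using s False uv by (auto simp: ab leading_def)
    have "\<not> (u = a \<and> v = a)" using uv(4) False by auto
    moreover have "\<not> (u = a \<and> v = b)" "\<not> (u = b \<and> v = a)" using q(2) by (auto simp: p uv(1))
    ultimately show ?thesis using top sec unfolding p uv(1)
      by (cases "u = a"; cases "v = a"; cases "u = b"; cases "v = b") auto
  qed
qed

text \<open>The same argument with ties allowed; uniqueness of the optimal pair is lost, but its
  value is still maximal.\<close>

lemma leader_pair_max:
  assumes s: "leading (\<le>) c i s" and q: "q \<in> out_pairs i"
  shows "(\<Sum>j\<in>#q. c j) \<le> (\<Sum>j\<in>#leader_pair i s. c j)"
proof -
  obtain a b where ab: "s = (a, b)" by (cases s)
  obtain u v where uv: "q = {#u, v#}" "u \<in> {1..i}" "v \<in> {1..i}" "u = v \<Longrightarrow> u = 1 \<or> u = i"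
    using q by (auto simp: out_pairs_def)
  have top: "c u \<le> c a" "c v \<le> c a"
    using s uv by (cases "u = a"; cases "v = a"; auto simp: ab leading_def)+
  show ?thesis
  proof (cases "a = 1 \<or> a = i")
    case True
    then have "leader_pair i s = {#a, a#}"
      using s by (auto simp: ab leading_def leader_pair_def)
    then show ?thesis using top uv(1) by simp
  next
    case False
    then have p: "leader_pair i s = {#a, b#}"
      by (auto simp: ab leader_pair_def)
    have sec: "u \<noteq> a \<Longrightarrow> c u \<le> c b" "v \<noteq> a \<Longrightarrow> c v \<le> c b"
      using s False uv by (cases "u = b"; cases "v = b"; auto simp: ab leading_def)+
    have "\<not> (u = a \<and> v = a)" using uv(4) False by auto
    then show ?thesis using top sec unfolding p uv(1) by (cases "u = a") auto
  qed
qed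

lemma leading_cong:
  assumes "\<And>j. j \<in> {1..i} \<Longrightarrow> c j = d j"
  shows "leading R c i s \<longleftrightarrow> leading R d i s"
  using assms by (cases s) (auto simp: leading_def)

lemma leader_pair_in_out_pairs:
  assumes "leading R c i s"
  shows "leader_pair i s \<in> out_pairs i"
proof -
  obtain a b where "s = (a, b)" by (cases s)
  then show ?thesis
    using assms by (cases "a = 1") (auto simp: leading_def leader_pair_def out_pairs_def)
qed

section \<open>Histories and weights\<close>

text \<open>The history is built by comparing each new value with those of the current leader and
  runner-up. Ties are decided in favour of the older positions.\<close>

lemma ex_leader_path:
  "\<exists>s\<in>leader_paths m. \<forall>i\<in>{1..Suc m}. leading (\<le>) c i (s i)"
proof (induction m)
  case 0
  show ?case by (auto simp: leading_def)
next
  case (Suc m)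
  then obtain s where s: "s \<in> leader_paths m" "\<And>i. i \<in> {1..Suc m} \<Longrightarrow> leading (\<le>) c i (s i)"
    by blast
  obtain a b where ab: "s (Suc m) = (a, b)" by (cases "s (Suc m)")
  have l: "leading (\<le>) c (Suc m) (a, b)" using s(2)[of "Suc m"] by (simp add: ab)
  have top: "c j \<le> c a" if "j \<in> {1..Suc m}" for j
    using l that by (cases "j = a") (auto simp: leading_def)
  have ints: "{1..Suc (Suc m)} = insert (Suc (Suc m)) {1..Suc m}" by auto
  have "\<exists>t\<in>next_leaders (Suc m) (a, b). leading (\<le>) c (Suc (Suc m)) t"
  proof -
    consider "c a < c (Suc (Suc m))" | "c (Suc (Suc m)) \<le> c a" "a = 1"
      | "c b < c (Suc (Suc m))" "c (Suc (Suc m)) \<le> c a" "a \<noteq> 1"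
      | "c (Suc (Suc m)) \<le> c b" "c (Suc (Suc m)) \<le> c a" "a \<noteq> 1"
      by linarith
    then show ?thesis
    proof cases
      case 1
      have "c j \<le> c (Suc (Suc m))" if "j \<in> {1..Suc m}" for j
        using top[OF that] 1 by simp
      then have "leading (\<le>) c (Suc (Suc m)) (Suc (Suc m), a)"
        using l top unfolding leading_def ints by auto
      moreover have "(Suc (Suc m), a) \<in> next_leaders (Suc m) (a, b)"
        by (auto simp: next_leaders_def)
      ultimately show ?thesis by blast
    next
      case 2
      have "leading (\<le>) c (Suc (Suc m)) (1, 1)"
        using l 2 by (auto simp: leading_def le_Suc_eq)
      moreover have "(1, 1) \<in> next_leaders (Suc m) (a, b)"
        using 2 by (auto simp: next_leaders_def)
      ultimately show ?thesis by blast
    next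
      case 3
      \<comment> \<open>The runner-up bounds every value but the leader's, so a new value above it
        becomes the second largest.\<close>
      have "c j \<le> c b" if "j \<in> {1..Suc m}" "j \<noteq> a" for j
        using l 3 that by (cases "j = b") (auto simp: leading_def)
      then have "c j \<le> c (Suc (Suc m))" if "j \<in> {1..Suc m}" "j \<noteq> a" for j
        using that 3(1) by (meson less_imp_le order_trans)
      then have "leading (\<le>) c (Suc (Suc m)) (a, Suc (Suc m))"
        using l top 3(2,3) unfolding leading_def ints by auto
      moreover have "(a, Suc (Suc m)) \<in> next_leaders (Suc m) (a, b)"
        using 3 by (auto simp: next_leaders_def)
      ultimately show ?thesis by blast
    next
      case 4
      have "leading (\<le>) c (Suc (Suc m)) (a, b)"
        using l 4 by (auto simp: leading_def le_Suc_eq)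
      moreover have "(a, b) \<in> next_leaders (Suc m) (a, b)"
        using 4 by (auto simp: next_leaders_def)
      ultimately show ?thesis by blast
    qed
  qed
  then obtain t where t: "t \<in> next_leaders (Suc m) (s (Suc m))" "leading (\<le>) c (Suc (Suc m)) t"
    by (auto simp: ab)
  have "s(Suc (Suc m) := t) \<in> leader_paths (Suc m)" using s(1) t(1) by auto
  moreover have "leading (\<le>) c i ((s(Suc (Suc m) := t)) i)" if "i \<in> {1..Suc (Suc m)}" for i
    using that s(2)[of i] t(2) by (cases "i = Suc (Suc m)") auto
  ultimately show ?case by blast
qed

text \<open>Any prescribed continuation can be forced by the value at the new position alone,
  leaving earlier values and hence earlier states intact.\<close>

lemma leader_path_realised:
  "s \<in> leader_paths m \<Longrightarrow> \<exists>c. \<forall>i\<in>{1..Suc m}. leading (<) c i (s i)"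
proof (induction m arbitrary: s)
  case 0
  then show ?case by (auto simp: leading_def)
next
  case (Suc m)
  then obtain s0 t where s0: "s0 \<in> leader_paths m" and t: "t \<in> next_leaders (Suc m) (s0 (Suc m))"
    and s: "s = s0(Suc (Suc m) := t)" by auto
  obtain c where c: "\<And>i. i \<in> {1..Suc m} \<Longrightarrow> leading (<) c i (s0 i)"
    using Suc.IH[OF s0] by blast
  obtain a b where ab: "s0 (Suc m) = (a, b)" by (cases "s0 (Suc m)")
  have l: "leading (<) c (Suc m) (a, b)" using c[of "Suc m"] by (simp add: ab)
  \<comment> \<open>The three values lie above the leader, strictly between leader and runner-up,
    and below the runner-up. If \<open>t = (1, 1)\<close>, then \<open>a = b = 1\<close> and the
    last choice puts the new value below the leader.\<close>
  define x where "x = (if fst t = Suc (Suc m) then c a + 1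
    else if snd t = Suc (Suc m) then (c a + c b) / 2 else c b - 1)"
  define d where "d = c(Suc (Suc m) := x)"
  have le: "a \<le> Suc m" "b \<le> Suc m" using l by (auto simp: leading_def)
  have ltop: "j \<in> {1..Suc m} \<Longrightarrow> j \<noteq> a \<Longrightarrow> c j < c a" for j
    using l by (auto simp: leading_def)
  have lsec: "j \<in> {1..Suc m} \<Longrightarrow> a \<noteq> 1 \<Longrightarrow> j \<noteq> a \<Longrightarrow> j \<noteq> b \<Longrightarrow> c j < c b" for j
    using l by (auto simp: leading_def)
  have lab: "a \<in> {1..Suc m}" "b \<in> {1..Suc m}" "a = 1 \<Longrightarrow> b = 1" "a \<noteq> 1 \<Longrightarrow> b \<noteq> a" "a \<noteq> 1 \<Longrightarrow> c b < c a"
    using l by (auto simp: leading_def split: if_splits)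
  have old: "d j = c j" if "j \<in> {1..Suc m}" for j using that by (auto simp: d_def)
  have ints: "{1..Suc (Suc m)} = insert (Suc (Suc m)) {1..Suc m}" by auto
  have "leading (<) d (Suc (Suc m)) t"
  proof -
    consider "t = (Suc (Suc m), a)" | "t = (1, 1)" "a = 1" | "t = (a, Suc (Suc m))" "a \<noteq> 1"
      | "t = (a, b)" "a \<noteq> 1"
      using t by (auto simp: ab next_leaders_def split: if_splits)
    then show ?thesis
    proof cases
      case 1
      then have x: "d (Suc (Suc m)) = c a + 1" by (simp add: d_def x_def)
      have "c j < c a + 1" if "j \<in> {1..Suc m}" for j
        using ltop[OF that] by (cases "j = a") auto
      then show ?thesis
        using 1 lab ltop unfolding leading_def ints by (auto simp: x old)
    next
      case 2
      then have x: "d (Suc (Suc m)) = c 1 - 1" using lab by (simp add: d_def x_def)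
      then show ?thesis
        using 2 lab ltop unfolding leading_def ints by (auto simp: x old)
    next
      case 3
      then have x: "d (Suc (Suc m)) = (c a + c b) / 2" using le by (simp add: d_def x_def)
      have "c j < (c a + c b) / 2" if "j \<in> {1..Suc m}" "j \<noteq> a" for j
        using lsec[OF that(1) 3(2) that(2)] lab(5)[OF 3(2)] by (cases "j = b") auto
      then show ?thesis
        using 3 lab ltop le unfolding leading_def ints by (auto simp: x old)
    next
      case 4
      then have x: "d (Suc (Suc m)) = c b - 1" using le by (simp add: d_def x_def)
      have below: "c b - 1 < c a" using lab(5)[OF 4(2)] by simp
      then show ?thesis
        using 4 lab ltop lsec le below unfolding leading_def ints by (auto simp: x old)
    qed
  qed
  moreover have "leading (<) d i (s0 i)" if "i \<in> {1..Suc m}" for i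
    using c[OF that] leading_cong[of i c d] that by (auto simp: d_def)
  ultimately have "leading (<) d i (s i)" if "i \<in> {1..Suc (Suc m)}" for i
    using that by (cases "i = Suc (Suc m)") (auto simp: s)
  then show ?case by blast
qed

section \<open>Distinct histories give distinct pairs\<close>

text \<open>By induction both histories extend the same one, and different continuations of one
  state yield different pairs.\<close>

lemma leader_path_eqI:
  assumes "s \<in> leader_paths m" "s' \<in> leader_paths m"
    and "\<And>i. i \<in> {1..Suc m} \<Longrightarrow> leader_pair i (s i) = leader_pair i (s' i)"
  shows "s = s'"
  using assms
proof (induction m arbitrary: s s')
  case 0
  then show ?case by simp
next
  case (Suc m)
  obtain s0 t where s: "s0 \<in> leader_paths m" "t \<in> next_leaders (Suc m) (s0 (Suc m))"
    "s = s0(Suc (Suc m) := t)" using Suc.prems(1) by auto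
  obtain s0' t' where s': "s0' \<in> leader_paths m" "t' \<in> next_leaders (Suc m) (s0' (Suc m))"
    "s' = s0'(Suc (Suc m) := t')" using Suc.prems(2) by auto
  have eq: "s0 = s0'"
  proof (rule Suc.IH[OF s(1) s'(1)])
    fix i assume "i \<in> {1..Suc m}"
    then show "leader_pair i (s0 i) = leader_pair i (s0' i)"
      using Suc.prems(3)[of i] by (auto simp: s(3) s'(3))
  qed
  obtain a b where ab: "s0 (Suc m) = (a, b)" by (cases "s0 (Suc m)")
  \<comment> \<open>A realising weight serves here only to supply the bounds on \<open>a\<close> and
    \<open>b\<close> and their distinctness.\<close>
  obtain c where "leading (<) c (Suc m) (a, b)"
    using leader_path_realised[OF s(1)] ab by force
  then have "a \<le> Suc m" "b \<le> Suc m" "a \<noteq> 1 \<Longrightarrow> a \<noteq> b" by (auto simp: leading_def)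
  \<comment> \<open>The supports suffice: with \<open>k\<close> for the new position they are
    \<open>{k}\<close>, \<open>{a, k}\<close> and \<open>{a, b}\<close> if
    \<open>a \<noteq> 1\<close>, and \<open>{1}\<close> and \<open>{k}\<close> otherwise.\<close>
  moreover have "set_mset (leader_pair (Suc (Suc m)) t) = set_mset (leader_pair (Suc (Suc m)) t')"
    using Suc.prems(3)[of "Suc (Suc m)"] by (simp add: s(3) s'(3))
  ultimately have "t = t'"
    using s(2) s'(2) unfolding eq[symmetric] ab
    by (auto simp: next_leaders_def leader_pair_def doubleton_eq_iff split: if_splits)
  then show ?case using eq by (simp add: s(3) s'(3))
qed

section \<open>Counting histories\<close>

text \<open>\<open>leading\<close> ensures that \<open>Suc i\<close> is a new position different
  from \<open>1\<close> and that \<open>a \<noteq> b\<close> when \<open>a \<noteq> 1\<close>, so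
  the listed continuations are distinct and a lost lead of \<open>1\<close> is never
  regained.\<close>

lemma card_next_leaders:
  assumes "leading R c i (a, b)"
  shows "card {t \<in> next_leaders i (a, b). fst t = 1} = (if a = 1 then 1 else 0)"
    and "card {t \<in> next_leaders i (a, b). fst t \<noteq> 1} = (if a = 1 then 1 else 3)"
proof -
  have l: "a \<in> {1..i}" "b \<in> {1..i}" "a = 1 \<Longrightarrow> b = 1" "a \<noteq> 1 \<Longrightarrow> b \<noteq> a"
    using assms by (auto simp: leading_def split: if_splits)
  show "card {t \<in> next_leaders i (a, b). fst t = 1} = (if a = 1 then 1 else 0)"
  proof (cases "a = 1")
    case True
    then have "{t \<in> next_leaders i (a, b). fst t = 1} = {(1, 1)}"
      using l by (auto simp: next_leaders_def)
    then show ?thesis using True by simp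
  next
    case False
    then have none: "{t \<in> next_leaders i (a, b). fst t = 1} = {}"
      using l by (auto simp: next_leaders_def)
    show ?thesis unfolding none using False by simp
  qed
  show "card {t \<in> next_leaders i (a, b). fst t \<noteq> 1} = (if a = 1 then 1 else 3)"
  proof (cases "a = 1")
    case True
    then have "{t \<in> next_leaders i (a, b). fst t \<noteq> 1} = {(Suc i, 1)}"
      using l by (auto simp: next_leaders_def)
    then show ?thesis using True by simp
  next
    case False
    then have "{t \<in> next_leaders i (a, b). fst t \<noteq> 1} = {(Suc i, a), (a, Suc i), (a, b)}"
      using l by (auto simp: next_leaders_def)
    then show ?thesis using False l by auto
  qed
qed

lemma finite_leader_paths: "finite (leader_paths m)"
  by (induction m) (auto simp: next_leaders_def split: prod.splits)

lemma leader_path_beyond: "s \<in> leader_paths m \<Longrightarrow> i > Suc m \<Longrightarrow> s i = (1, 1)"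
  by (induction m arbitrary: s) auto

text \<open>A history splits uniquely into a shorter one and a last state, so counting by a property
  of that state reduces to counting continuations.\<close>

lemma card_leader_paths_Suc:
  "card {s \<in> leader_paths (Suc m). P (s (Suc (Suc m)))} =
     (\<Sum>s\<in>leader_paths m. card {t \<in> next_leaders (Suc m) (s (Suc m)). P t})"
proof -
  let ?f = "\<lambda>(s, t). s(Suc (Suc m) := t)"
  let ?A = "SIGMA s:leader_paths m. {t \<in> next_leaders (Suc m) (s (Suc m)). P t}"
  have "inj_on ?f ?A"
  proof (rule inj_onI)
    fix x y assume xy: "x \<in> ?A" "y \<in> ?A" "?f x = ?f y"
    obtain s t s' t' where st: "x = (s, t)" "y = (s', t')" by (cases x, cases y)
    have s: "s \<in> leader_paths m" "s' \<in> leader_paths m"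
      and eq: "s(Suc (Suc m) := t) = s'(Suc (Suc m) := t')"
      using xy by (simp_all add: st)
    \<comment> \<open>The update hides the old values at \<open>Suc (Suc m)\<close>, but both
      functions have the default \<open>(1, 1)\<close> there.\<close>
    have "s i = s' i" for i
      using fun_cong[OF eq, of i] leader_path_beyond[OF s(1), of i] leader_path_beyond[OF s(2), of i]
      by (cases "i = Suc (Suc m)") auto
    moreover have "t = t'" using fun_cong[OF eq, of "Suc (Suc m)"] by simp
    ultimately show "x = y" by (auto simp: st)
  qed
  moreover have "{s \<in> leader_paths (Suc m). P (s (Suc (Suc m)))} = ?f ` ?A" by force
  ultimately have "card {s \<in> leader_paths (Suc m). P (s (Suc (Suc m)))} = card ?A"
    by (simp add: card_image)
  also have "\<dots> = (\<Sum>s\<in>leader_paths m. card {t \<in> next_leaders (Suc m) (s (Suc m)). P t})"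
    by (rule card_SigmaI) (auto simp: finite_leader_paths next_leaders_def split: prod.splits)
  finally show ?thesis .
qed

text \<open>If \<open>B\<close> histories have lost the leader \<open>1\<close>, the next count is
  \<open>3 * B + 1\<close>, and \<open>2 * (3 * B + 1) + 1 = 3 * (2 * B + 1)\<close>.\<close>

lemma card_leader_paths_aux:
  "card {s \<in> leader_paths m. fst (s (Suc m)) = 1} = 1 \<and>
   2 * card {s \<in> leader_paths m. fst (s (Suc m)) \<noteq> 1} + 1 = 3 ^ m"
proof (induction m)
  case 0
  have "{s \<in> leader_paths 0. fst (s (Suc 0)) = 1} = {\<lambda>_. (1, 1)}" by auto
  then show ?case by auto
next
  case (Suc m)
  let ?A = "{s \<in> leader_paths m. fst (s (Suc m)) = 1}"
  let ?B = "{s \<in> leader_paths m. fst (s (Suc m)) \<noteq> 1}"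
  have split: "(\<Sum>s\<in>leader_paths m. if fst (s (Suc m)) = 1 then x else y)
      = card ?A * x + card ?B * y" for x y :: nat
    using finite_leader_paths[of m] by (simp add: sum.If_cases Int_def conj_commute)
  have l: "\<exists>c. leading (<) c (Suc m) (fst (s (Suc m)), snd (s (Suc m)))" if "s \<in> leader_paths m" for s
    using leader_path_realised[OF that] by force
  have n: "card {t \<in> next_leaders (Suc m) (s (Suc m)). fst t = 1}
        = (if fst (s (Suc m)) = 1 then 1 else 0)"
    "card {t \<in> next_leaders (Suc m) (s (Suc m)). fst t \<noteq> 1} = (if fst (s (Suc m)) = 1 then 1 else 3)"
    if s: "s \<in> leader_paths m" for s
  proof -
    obtain c where "leading (<) c (Suc m) (fst (s (Suc m)), snd (s (Suc m)))" using l[OF s] by blast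
    from card_next_leaders[OF this] show
      "card {t \<in> next_leaders (Suc m) (s (Suc m)). fst t = 1} = (if fst (s (Suc m)) = 1 then 1 else 0)"
      "card {t \<in> next_leaders (Suc m) (s (Suc m)). fst t \<noteq> 1} = (if fst (s (Suc m)) = 1 then 1 else 3)"
      by simp_all
  qed
  have "card {s \<in> leader_paths (Suc m). fst (s (Suc (Suc m))) = 1} = card ?A"
    unfolding card_leader_paths_Suc[of m "\<lambda>t. fst t = 1"] 
    by (subst sum.cong[OF refl n(1)]) (assumption, simp only: split mult_1_right mult_0_right add_0_right)
  moreover have "card {s \<in> leader_paths (Suc m). fst (s (Suc (Suc m))) \<noteq> 1} = card ?A + card ?B * 3"
    unfolding card_leader_paths_Suc[of m "\<lambda>t. fst t \<noteq> 1"] 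
    by (subst sum.cong[OF refl n(2)]) (assumption, simp only: split mult_1_right mult_0_right add_0_right)
  ultimately show ?case using Suc.IH by simp
qed

lemma card_leader_paths: "2 * card (leader_paths m) = 3 ^ m + 1"
proof -
  have "leader_paths m = {s \<in> leader_paths m. fst (s (Suc m)) = 1} \<union> {s \<in> leader_paths m. fst (s (Suc m)) \<noteq> 1}"
    by auto
  then have "card (leader_paths m) = card {s \<in> leader_paths m. fst (s (Suc m)) = 1}
      + card {s \<in> leader_paths m. fst (s (Suc m)) \<noteq> 1}"
    using finite_leader_paths[of m] by (subst card_Un_disjoint[symmetric]) auto
  then show ?thesis using card_leader_paths_aux[of m] by simp
qed

section \<open>Bijection between histories and corners\<close>

theorem proposition4p5:
  fixes n :: nat and lab :: "'n::finite \<Rightarrow> nat"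
  assumes "n \<ge> 1"
    and "bij_betw lab (UNIV :: 'n set) {1..n}"
  shows "real (card {x. x extreme_point_of (degree_polytope lab n)}) = (3 ^ (n - 1) + 1) / 2"
proof -
  obtain m where n: "n = Suc m" using assms(1) by (cases n) auto
  define V where "V = degree_vector lab n ` digraph_family n"
  define corner where "corner = (\<lambda>s. pair_vector lab n (\<lambda>i. leader_pair i (s i)))"
  have inj: "inj lab" using assms(2) by (simp add: bij_betw_def)
  have V: "V = pair_vector lab n ` (\<Pi>\<^sub>E i\<in>{1..n}. out_pairs i)"
    unfolding V_def by (rule degree_vector_image)
  have fin: "finite V"
    unfolding V by (intro finite_imageI finite_PiE) (auto simp: finite_out_pairs)
  have vec_in_V: "pair_vector lab n p \<in> V" if "p \<in> (\<Pi> i\<in>{1..n}. out_pairs i)" for p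
    unfolding V
  proof (rule image_eqI)
    show "pair_vector lab n p = pair_vector lab n (restrict p {1..n})"
      by (rule pair_vector_restrict[symmetric])
    show "restrict p {1..n} \<in> (\<Pi>\<^sub>E i\<in>{1..n}. out_pairs i)"
      using that by auto
  qed
  have pairs: "(\<lambda>i. leader_pair i (s i)) \<in> (\<Pi> i\<in>{1..n}. out_pairs i)" if "s \<in> leader_paths m" for s
    using leader_path_realised[OF that] leader_pair_in_out_pairs n by fast
  \<comment> \<open>The comparison is between tuples of pairs rather than vectors. It thus shows
    both that \<open>corner s\<close> is a strict maximiser and that no other tuple produces the
    same vector.\<close>
  have max: "\<exists>y. \<forall>q\<in>(\<Pi> i\<in>{1..n}. out_pairs i).
      (\<exists>i\<in>{1..n}. q i \<noteq> leader_pair i (s i)) \<longrightarrow> y \<bullet> pair_vector lab n q < y \<bullet> corner s"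
    if s: "s \<in> leader_paths m" for s
  proof -
    obtain c where c: "\<And>i. i \<in> {1..n} \<Longrightarrow> leading (<) c i (s i)"
      using leader_path_realised[OF s] n by blast
    define y :: "real ^ 'n" where "y = (\<chi> k. c (lab k))"
    have cy: "c (lab k) = y $ k" for k by (simp add: y_def)
    have "y \<bullet> pair_vector lab n q < y \<bullet> corner s"
      if q: "q \<in> (\<Pi> i\<in>{1..n}. out_pairs i)" and i: "i \<in> {1..n}" "q i \<noteq> leader_pair i (s i)" for q i
    proof -
      have lt: "(\<Sum>j\<in>#q i. c j) < (\<Sum>j\<in>#leader_pair i (s i). c j)"
        if "i \<in> {1..n}" "q i \<noteq> leader_pair i (s i)" for i
        using leader_pair_strict_max[OF c[OF that(1)] _ that(2)] q that(1) by blast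
      have "(\<Sum>i = 1..n. \<Sum>j\<in>#q i. c j) < (\<Sum>i = 1..n. \<Sum>j\<in>#leader_pair i (s i). c j)"
      proof (rule sum_strict_mono_ex1)
        show "\<forall>i\<in>{1..n}. (\<Sum>j\<in>#q i. c j) \<le> (\<Sum>j\<in>#leader_pair i (s i). c j)"
          using lt by (metis less_imp_le order_refl)
        show "\<exists>i\<in>{1..n}. (\<Sum>j\<in>#q i. c j) < (\<Sum>j\<in>#leader_pair i (s i). c j)"
          using lt[OF i] i(1) by blast
      qed simp
      then show ?thesis
        unfolding corner_def inner_pair_vector[OF assms(2) q cy]
          inner_pair_vector[OF assms(2) pairs[OF s] cy]
        using n by (simp add: divide_strict_right_mono)
    qed
    then show ?thesis by blast
  qed
  have "{x. x extreme_point_of (degree_polytope lab n)} = corner ` leader_paths m"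
  proof (intro equalityI subsetI)
    fix x assume "x \<in> {x. x extreme_point_of (degree_polytope lab n)}"
    then have "x extreme_point_of (convex hull V)" by (simp add: degree_polytope_def V_def)
    then obtain y where y: "x \<in> V" "\<And>z. z \<in> V \<Longrightarrow> z \<noteq> x \<Longrightarrow> y \<bullet> z < y \<bullet> x"
      using extreme_point_of_convex_hull_iff[OF fin] by blast
    \<comment> \<open>The functional is transported to positions along the inverse of
      \<open>lab\<close>, and a history of these weights gives the candidate corner.\<close>
    define c where "c = (\<lambda>j. y $ inv lab j)"
    have cy: "c (lab k) = y $ k" for k by (simp add: c_def inj)
    obtain s where s: "s \<in> leader_paths m" "\<And>i. i \<in> {1..n} \<Longrightarrow> leading (\<le>) c i (s i)"
      using ex_leader_path[of m c] n by blast
    obtain q where q: "q \<in> (\<Pi> i\<in>{1..n}. out_pairs i)" "x = pair_vector lab n q"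
      using y(1) unfolding V by (auto simp: PiE_def)
    have "(\<Sum>i = 1..n. \<Sum>j\<in>#q i. c j) \<le> (\<Sum>i = 1..n. \<Sum>j\<in>#leader_pair i (s i). c j)"
      by (rule sum_mono) (rule leader_pair_max[OF s(2)], use q(1) in auto)
    then have "y \<bullet> x \<le> y \<bullet> corner s"
      unfolding q(2) corner_def inner_pair_vector[OF assms(2) q(1) cy]
        inner_pair_vector[OF assms(2) pairs[OF s(1)] cy]
      by (simp add: divide_right_mono)
    moreover have "corner s \<in> V" unfolding corner_def by (rule vec_in_V[OF pairs[OF s(1)]])
    \<comment> \<open>\<open>x\<close> is the only maximiser of \<open>y\<close> on
      \<open>V\<close>, yet \<open>corner s\<close> does at least as well.\<close>
    ultimately have "x = corner s" using y(2)[of "corner s"] by force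
    then show "x \<in> corner ` leader_paths m" using s(1) by blast
  next
    fix x assume "x \<in> corner ` leader_paths m"
    then obtain s where s: "s \<in> leader_paths m" "x = corner s" by blast
    obtain y where y: "\<And>q i. q \<in> (\<Pi> i\<in>{1..n}. out_pairs i) \<Longrightarrow> i \<in> {1..n} \<Longrightarrow>
        q i \<noteq> leader_pair i (s i) \<Longrightarrow> y \<bullet> pair_vector lab n q < y \<bullet> corner s"
      using max[OF s(1)] by blast
    have "y \<bullet> z < y \<bullet> x" if z: "z \<in> V" "z \<noteq> x" for z
    proof -
      obtain q where q: "q \<in> (\<Pi> i\<in>{1..n}. out_pairs i)" "z = pair_vector lab n q"
        using z(1) unfolding V by (auto simp: PiE_def)
      have "\<exists>i\<in>{1..n}. q i \<noteq> leader_pair i (s i)"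
      proof (rule ccontr)
        assume "\<not> ?thesis"
        then have "z = x" by (simp add: q(2) s(2) corner_def pair_vector_def)
        then show False using z(2) by simp
      qed
      then show ?thesis using y[OF q(1)] q(2) s(2) by blast
    qed
    moreover have "x \<in> V" unfolding s(2) corner_def by (rule vec_in_V[OF pairs[OF s(1)]])
    ultimately have "x extreme_point_of (convex hull V)"
      unfolding extreme_point_of_convex_hull_iff[OF fin] by blast
    then show "x \<in> {x. x extreme_point_of (degree_polytope lab n)}"
      by (simp add: degree_polytope_def V_def)
  qed
  moreover have "inj_on corner (leader_paths m)"
  proof (rule inj_onI)
    fix s s' assume s: "s \<in> leader_paths m" "s' \<in> leader_paths m" and eq: "corner s = corner s'"
    \<comment> \<open>If the pairs differed at \<open>i\<close>, the functional for \<open>s\<close>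
      would be strictly smaller at \<open>corner s'\<close> than at \<open>corner s\<close>,
      although these are equal.\<close>
    have "leader_pair i (s i) = leader_pair i (s' i)" if "i \<in> {1..n}" for i
      using max[OF s(1)] pairs[OF s(2)] that eq unfolding corner_def by (metis less_irrefl)
    then show "s = s'" using leader_path_eqI[OF s] n by blast
  qed
  ultimately have "card {x. x extreme_point_of (degree_polytope lab n)} = card (leader_paths m)"
    by (simp add: card_image)
  moreover have "2 * real (card (leader_paths m)) = 3 ^ m + 1"
    using arg_cong[OF card_leader_paths[of m], of real] by simp
  ultimately show ?thesis using n by simp
qed

end
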